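(* Let $(\mathfrak{g},\langle\,,\rangle)$ be a flat pseudo-Euclidean 2-step nilpotent Lie algebra (of any signature). Then: 1. $Z(\mathfrak{g})$ is degenerate, i.e. $Z(\mathfrak{g})\cap Z(\mathfrak{g})^\perp\ne\{0\}$. 2. For any $e\in Z(\mathfrak{g})\cap Z(\mathfrak{g})^\perp$, $\mathrm{L}_e=\mathrm{R}_e=0$. 3. For any $x,y\in Z(\mathfrak{g})^\perp$, $\langle[x,y],[x,y]\rangle=0$.
   Context: A pseudo-Euclidean Lie algebra $(\mathfrak{g},\langle\,,\rangle)$ is a finite-dimensional real Lie algebra with a non-degenerate symmetric bilinear form. Its Levi-Civita product $(u,v)\mapsto u.v$ is defined by $2\langle u.v,w\rangle=\langle[u,v],w\rangle+\langle[w,u],v\rangle+\langle[w,v],u\rangle$ for all $u,v,w\in\mathfrak{g}$. Write $\mathrm{L}_u v=u.v$ and $\mathrm{R}_uv=v.u$. It is flat if the Levi-Civita product is left symmetric: $(u.v).w-u.(v.w)=(v.u).w-v.(u.w)$ for all $u,v,w$; equivalently $\mathrm{L}_{[u,v]}=[\mathrm{L}_u,\mathrm{L}_v]$. A 2-step nilpotent Lie algebra is a non-abelian Lie algebra with $[\mathfrak{g},\mathfrak{g}]\subset Z(\mathfrak{g})$, where $Z(\mathfrak{g})$ is the center. $\perp$ denotes the orthogonal with respect to $\langle\,,\rangle$. *)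

theory Defs
  imports "HOL-Analysis.Analysis"
begin

text \<open>
  The Lie algebra is the whole type \<open>'a :: real_vector\<close>, finitely generated as a vector space;
  no norm or topology is involved. The form may have any signature.
\<close>

locale real_lie_algebra =
  fixes bracket :: "'a::real_vector \<Rightarrow> 'a \<Rightarrow> 'a"
  assumes finite_dim: "\<exists>B :: 'a set. finite B \<and> span B = UNIV"
    and bilinear_bracket: "bilinear bracket"
    and alternating: "bracket x x = 0"
    and jacobi: "bracket x (bracket y z) + bracket y (bracket z x) + bracket z (bracket x y) = 0"

locale pseudo_euclidean_lie_algebra = real_lie_algebra bracket
  for bracket :: "'a::real_vector \<Rightarrow> 'a \<Rightarrow> 'a" +
  fixes form :: "'a \<Rightarrow> 'a \<Rightarrow> real"
  assumes bilinear_form: "bilinear form"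
    and form_sym: "form u v = form v u"
    and form_nondegenerate: "(\<And>v. form u v = 0) \<Longrightarrow> u = 0"

definition lie_center :: "('a::real_vector \<Rightarrow> 'a \<Rightarrow> 'a) \<Rightarrow> 'a set" where
  "lie_center bracket = {z. \<forall>x. bracket z x = 0}"

definition derived_algebra :: "('a::real_vector \<Rightarrow> 'a \<Rightarrow> 'a) \<Rightarrow> 'a set" where
  "derived_algebra bracket = span {bracket x y | x y. True}"

definition abelian :: "('a::real_vector \<Rightarrow> 'a \<Rightarrow> 'a) \<Rightarrow> bool" where
  "abelian bracket \<longleftrightarrow> (\<forall>x y. bracket x y = 0)"

definition two_step_nilpotent :: "('a::real_vector \<Rightarrow> 'a \<Rightarrow> 'a) \<Rightarrow> bool" where
  "two_step_nilpotent bracket \<longleftrightarrow>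
     \<not> abelian bracket \<and> derived_algebra bracket \<subseteq> lie_center bracket"

definition form_orthogonal :: "('a \<Rightarrow> 'a \<Rightarrow> real) \<Rightarrow> 'a set \<Rightarrow> 'a set" where
  "form_orthogonal form S = {u. \<forall>v\<in>S. form u v = 0}"

definition degenerate_subspace :: "('a::real_vector \<Rightarrow> 'a \<Rightarrow> real) \<Rightarrow> 'a set \<Rightarrow> bool" where
  "degenerate_subspace form S \<longleftrightarrow> S \<inter> form_orthogonal form S \<noteq> {0}"

text \<open>
  The description below has exactly one solution in a pseudo-Euclidean Lie algebra;
  see \<open>levi_civita_ex1\<close> and \<open>levi_civita\<close>.
\<close>

definition levi_civita ::
  "('a::real_vector \<Rightarrow> 'a \<Rightarrow> 'a) \<Rightarrow> ('a \<Rightarrow> 'a \<Rightarrow> real) \<Rightarrow> 'a \<Rightarrow> 'a \<Rightarrow> 'a" where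
  "levi_civita bracket form u v =
     (THE z. \<forall>w. 2 * form z w =
        form (bracket u v) w + form (bracket w u) v + form (bracket w v) u)"

definition left_mult ::
  "('a::real_vector \<Rightarrow> 'a \<Rightarrow> 'a) \<Rightarrow> ('a \<Rightarrow> 'a \<Rightarrow> real) \<Rightarrow> 'a \<Rightarrow> 'a \<Rightarrow> 'a" where
  "left_mult bracket form u = (\<lambda>v. levi_civita bracket form u v)"

definition right_mult ::
  "('a::real_vector \<Rightarrow> 'a \<Rightarrow> 'a) \<Rightarrow> ('a \<Rightarrow> 'a \<Rightarrow> real) \<Rightarrow> 'a \<Rightarrow> 'a \<Rightarrow> 'a" where
  "right_mult bracket form u = (\<lambda>v. levi_civita bracket form v u)"

definition left_symmetric :: "('a::real_vector \<Rightarrow> 'a \<Rightarrow> 'a) \<Rightarrow> bool" where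
  "left_symmetric p \<longleftrightarrow>
     (\<forall>u v w. p (p u v) w - p u (p v w) = p (p v u) w - p v (p u w))"

definition flat :: "('a::real_vector \<Rightarrow> 'a \<Rightarrow> 'a) \<Rightarrow> ('a \<Rightarrow> 'a \<Rightarrow> real) \<Rightarrow> bool" where
  "flat bracket form \<longleftrightarrow> left_symmetric (levi_civita bracket form)"

context pseudo_euclidean_lie_algebra
begin

lemma form_represents:
  assumes phi: "linear \<phi>"
  shows "\<exists>!z. \<forall>w. form z w = \<phi> w"
proof -
  obtain G :: "'a set" where G: "finite G" "span G = UNIV"
    using finite_dim by blast
  obtain B where B: "B \<subseteq> G" "independent B" "G \<subseteq> span B"
    using real_vector.maximal_independent_subset[of G] by blast
  have fB: "finite B" using B(1) G(1) finite_subset by blast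
  have spB: "span B = UNIV"
    using G(2) B(3) by (metis real_vector.span_mono real_vector.span_span top.extremum_uniqueI)
  interpret fd: finite_dimensional_vector_space "scaleR :: real \<Rightarrow> 'a \<Rightarrow> 'a" B
    by unfold_locales (use B(2) fB spB in
      \<open>auto simp: dependent_raw_def span_raw_def\<close>)
  have lin1: "linear (\<lambda>z. form z w)" and lin2: "linear (form z)" for z w
    using bilinear_form by (auto simp: bilinear_def)
  have coeff: "f = g" if "linear f" "linear g"
    and eq: "(\<Sum>b\<in>B. f b *\<^sub>R b) = (\<Sum>b\<in>B. g b *\<^sub>R b)" for f g :: "'a \<Rightarrow> real"
  proof -
    have "(\<Sum>b\<in>B. (f b - g b) *\<^sub>R b) = 0"
      using eq by (simp add: scaleR_left_diff_distrib sum_subtractf)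
    then have "f b - g b = 0" if "b \<in> B" for b
      using real_vector.independentD[OF B(2) fB order_refl, of "\<lambda>b. f b - g b"] that by blast
    then have "f x = g x" for x
      using linear_eq_on_span[OF that(1,2), of B x] spB by simp
    then show ?thesis by blast
  qed
  define T where "T z = (\<Sum>b\<in>B. form z b *\<^sub>R b)" for z
  have linT: "linear T"
    unfolding T_def
    by (rule linearI)
      (simp_all add: linear_add[OF lin1] linear_scale[OF lin1] scaleR_left_distrib
        sum.distrib scaleR_sum_right)
  have form_inj: "z = z'" if "\<And>w. form z w = form z' w" for z z'
  proof -
    have "form (z - z') w = 0" for w
      using that linear_diff[OF lin1] by simp
    then show ?thesis using form_nondegenerate by force
  qed
  have "inj T"
  proof (rule injI)
    fix z z' assume "T z = T z'"
    then have "form z = form z'"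
      using coeff[OF lin2 lin2] by (simp add: T_def)
    then show "z = z'" using form_inj by metis
  qed
  then have "surj T"
    using fd.linear_inj_imp_surj[OF linT[unfolded linear_def]] by simp
  then obtain z where "T z = (\<Sum>b\<in>B. \<phi> b *\<^sub>R b)" by (metis surjD)
  then have "form z = \<phi>"
    using coeff[OF lin2 phi] by (simp add: T_def)
  then show ?thesis using form_inj by metis
qed

lemma levi_civita_ex1:
  "\<exists>!z. \<forall>w. 2 * form z w =
     form (bracket u v) w + form (bracket w u) v + form (bracket w v) u"
proof -
  let ?\<phi> = "\<lambda>w. (form (bracket u v) w + form (bracket w u) v + form (bracket w v) u) / 2"
  have "linear ?\<phi>"
    by (rule linearI)
      (simp_all add: bilinear_ladd[OF bilinear_form] bilinear_radd[OF bilinear_form]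
        bilinear_lmul[OF bilinear_form] bilinear_rmul[OF bilinear_form]
        bilinear_ladd[OF bilinear_bracket] bilinear_lmul[OF bilinear_bracket] field_simps)
  from form_represents[OF this] show ?thesis by (simp add: field_simps)
qed

lemma levi_civita:
  "2 * form (levi_civita bracket form u v) w =
     form (bracket u v) w + form (bracket w u) v + form (bracket w v) u"
  using theI'[OF levi_civita_ex1[of u v]] unfolding levi_civita_def by blast

end

end

theory Submission
  imports Defs
begin

text \<open>
  Write \<open>u \<cdot> v\<close> for the Levi-Civita product and \<open>Z\<close> for the center. For \<open>z \<in> Z\<close> the Koszul
  formula collapses to \<open>2 \<langle>z \<cdot> v, w\<rangle> = \<langle>[w, v], z\<rangle>\<close>: multiplication by \<open>z\<close> is the bracket read off
  against \<open>z\<close>. Hence \<open>z \<cdot> v \<in> Z\<^sup>\<bottom>\<close>, and \<open>z \<cdot> v = 0\<close> for all \<open>v\<close> as soon as \<open>z\<close> is orthogonal to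
  all brackets. Moreover \<open>z \<cdot> v = v \<cdot> z\<close> by torsion-freeness. Since brackets are central, every
  \<open>e \<in> Z \<inter> Z\<^sup>\<bottom>\<close> is orthogonal to them, and so \<open>L\<^sub>e = R\<^sub>e = 0\<close>.

  Degeneracy. Flatness makes \<open>L\<^sub>z\<close> commute with every \<open>L\<^sub>y\<close>, so for central \<open>z, z'\<close> one gets
  \<open>z' \<cdot> (z \<cdot> y) = z' \<cdot> (y \<cdot> z) = y \<cdot> (z' \<cdot> z) = 0\<close>. Suppose \<open>Z \<inter> Z\<^sup>\<bottom> = 0\<close>. If \<open>z \<cdot> u = 0\<close> for all central
  \<open>z\<close>, then the brackets \<open>[w, u]\<close> lie in \<open>Z \<inter> Z\<^sup>\<bottom>\<close>, hence vanish, and \<open>u\<close> is central. Applied to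
  \<open>u = z \<cdot> y\<close> this puts \<open>z \<cdot> y\<close> in \<open>Z \<inter> Z\<^sup>\<bottom> = 0\<close>; applied then to an arbitrary \<open>y\<close> it makes \<open>y\<close>
  central, so the algebra would be abelian.

  Isotropy. For \<open>x, y \<in> Z\<^sup>\<bottom>\<close> the Koszul formula gives \<open>x \<cdot> y = [x, y] / 2\<close>. Pairing the flatness
  identity for \<open>[x, y] \<cdot> x\<close> with \<open>y\<close> evaluates \<open>\<langle>[x, y], [x, y]\<rangle>\<close> with the coefficient \<open>-1/2\<close> on one
  side and \<open>1/4\<close> on the other.
\<close>

context pseudo_euclidean_lie_algebra
begin

abbreviation levi_civita_product :: "'a \<Rightarrow> 'a \<Rightarrow> 'a" (infixl "\<cdot>" 70) where
  "u \<cdot> v \<equiv> levi_civita bracket form u v"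

abbreviation Z :: "'a set" where
  "Z \<equiv> lie_center bracket"

abbreviation Z_perp :: "'a set" where
  "Z_perp \<equiv> form_orthogonal form Z"

lemmas form_simps =
  bilinear_ladd[OF bilinear_form] bilinear_radd[OF bilinear_form]
  bilinear_lsub[OF bilinear_form] bilinear_rsub[OF bilinear_form]
  bilinear_lneg[OF bilinear_form] bilinear_rneg[OF bilinear_form]
  bilinear_lmul[OF bilinear_form] bilinear_rmul[OF bilinear_form]
  bilinear_lzero[OF bilinear_form] bilinear_rzero[OF bilinear_form]

lemma form_eqI:
  assumes "\<And>w. form u w = form v w"
  shows "u = v"
  using form_nondegenerate[of "u - v"] assms by (simp add: form_simps)

lemma bracket_antisym: "bracket u v = - bracket v u"
proof -
  have "bracket (u + v) (u + v) = bracket v u + bracket u v"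
    by (simp only: bilinear_ladd[OF bilinear_bracket] bilinear_radd[OF bilinear_bracket])
      (simp add: alternating)
  then show ?thesis by (metis add_eq_0_iff alternating)
qed

lemma center_bracket_left: "z \<in> Z \<Longrightarrow> bracket z v = 0"
  by (simp add: lie_center_def)

lemma center_bracket_right: "z \<in> Z \<Longrightarrow> bracket v z = 0"
  using bracket_antisym[of v z] center_bracket_left by simp

lemma center_orthogonal: "x \<in> Z_perp \<Longrightarrow> z \<in> Z \<Longrightarrow> form x z = 0"
  by (simp add: form_orthogonal_def)

lemma levi_civita_skew: "form (u \<cdot> v) w = - form v (u \<cdot> w)"
  using levi_civita[of u v w] levi_civita[of u w v]
    bracket_antisym[of w v] bracket_antisym[of w u] bracket_antisym[of v u]
  by (simp add: form_simps form_sym[of v "u \<cdot> w"])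

lemma levi_civita_torsion_free: "u \<cdot> v - v \<cdot> u = bracket u v"
proof (rule form_eqI)
  fix w
  show "form (u \<cdot> v - v \<cdot> u) w = form (bracket u v) w"
    using levi_civita[of u v w] levi_civita[of v u w] bracket_antisym[of v u]
    by (simp add: form_simps)
qed

lemma levi_civita_central:
  assumes "z \<in> Z"
  shows "2 * form (z \<cdot> v) w = form (bracket w v) z"
  using levi_civita[of z v w] assms
  by (simp add: center_bracket_left center_bracket_right form_simps)

lemma levi_civita_central_commute:
  assumes "z \<in> Z"
  shows "v \<cdot> z = z \<cdot> v"
  using levi_civita_torsion_free[of v z] center_bracket_right[OF assms] by simp

lemma levi_civita_central_perp:
  assumes "z \<in> Z"
  shows "z \<cdot> v \<in> Z_perp"
proof -
  have "form (z \<cdot> v) z' = 0" if "z' \<in> Z" for z'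
    using levi_civita_central[OF assms, of v z'] center_bracket_left[OF that]
    by (simp add: form_simps)
  then show ?thesis by (simp add: form_orthogonal_def)
qed

lemma levi_civita_center_center:
  assumes "z \<in> Z" "z' \<in> Z"
  shows "z \<cdot> z' = 0"
  using levi_civita_central[OF assms(1), of z'] center_bracket_right[OF assms(2)]
  by (intro form_eqI) (simp add: form_simps)

lemma levi_civita_zero_right: "u \<cdot> 0 = 0"
  using levi_civita[of u 0]
  by (intro form_eqI)
    (simp add: form_simps bilinear_rzero[OF bilinear_bracket])

lemma flat_left_symmetric:
  assumes "flat bracket form"
  shows "(u \<cdot> v) \<cdot> w - u \<cdot> (v \<cdot> w) = (v \<cdot> u) \<cdot> w - v \<cdot> (u \<cdot> w)"
  using assms by (simp add: flat_def left_symmetric_def)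

lemma flat_central_commute:
  assumes "flat bracket form" and "z \<in> Z"
  shows "z \<cdot> (x \<cdot> y) = x \<cdot> (z \<cdot> y)"
  using flat_left_symmetric[OF assms(1), of z x y] levi_civita_central_commute[OF assms(2), of x]
  by simp

text \<open>
  The inner product by a central element may be written on either side, so the outer factor
  can be commuted past \<open>y\<close> until it meets the other central element.
\<close>

lemma flat_central_central_zero:
  assumes "flat bracket form" and "z \<in> Z" "z' \<in> Z"
  shows "z' \<cdot> (z \<cdot> y) = 0"
proof -
  have "z' \<cdot> (z \<cdot> y) = z' \<cdot> (y \<cdot> z)"
    using levi_civita_central_commute[OF assms(2)] by simp
  also have "\<dots> = y \<cdot> (z' \<cdot> z)"
    by (rule flat_central_commute[OF assms(1,3)])
  also have "\<dots> = 0"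
    by (simp add: levi_civita_center_center assms levi_civita_zero_right)
  finally show ?thesis .
qed

lemma two_step_bracket_central:
  assumes "two_step_nilpotent bracket"
  shows "bracket x y \<in> Z"
proof -
  have "bracket x y \<in> derived_algebra bracket"
    unfolding derived_algebra_def by (rule span_base) blast
  then show ?thesis using assms unfolding two_step_nilpotent_def by blast
qed

text \<open>
  Annihilation by all central elements says that every bracket with \<open>u\<close> is orthogonal to the
  center; such a bracket is itself central, so nondegeneracy of the center kills it.
\<close>

lemma central_if_annihilated:
  assumes nil: "two_step_nilpotent bracket"
    and nondeg: "Z \<inter> Z_perp = {0}"
    and ann: "\<And>z. z \<in> Z \<Longrightarrow> z \<cdot> u = 0"
  shows "u \<in> Z"
proof -
  have "bracket w u = 0" for w
  proof -
    have "form (bracket w u) z = 0" if "z \<in> Z" for z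
      using levi_civita_central[OF that, of u w] ann[OF that] by (simp add: form_simps)
    then have "bracket w u \<in> Z \<inter> Z_perp"
      using two_step_bracket_central[OF nil] by (simp add: form_orthogonal_def)
    then show ?thesis using nondeg by simp
  qed
  then show ?thesis
    using bracket_antisym[of u] by (simp add: lie_center_def)
qed

lemma flat_two_step_center_degenerate:
  assumes nil: "two_step_nilpotent bracket" and flat: "flat bracket form"
  shows "degenerate_subspace form Z"
proof (rule ccontr)
  assume "\<not> degenerate_subspace form Z"
  then have nondeg: "Z \<inter> Z_perp = {0}" by (simp add: degenerate_subspace_def)
  have "z \<cdot> y = 0" if "z \<in> Z" for z y
  proof -
    have "z \<cdot> y \<in> Z"
      by (rule central_if_annihilated[OF nil nondeg])
        (rule flat_central_central_zero[OF flat that])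
    then show ?thesis using levi_civita_central_perp[OF that] nondeg by blast
  qed
  then have "y \<in> Z" for y
    by (intro central_if_annihilated[OF nil nondeg])
  then show False
    using nil center_bracket_left by (auto simp: two_step_nilpotent_def abelian_def)
qed

lemma two_step_center_perp_mult_zero:
  assumes nil: "two_step_nilpotent bracket" and e: "e \<in> Z" "e \<in> Z_perp"
  shows "e \<cdot> v = 0" and "v \<cdot> e = 0"
proof -
  show "e \<cdot> v = 0"
  proof (rule form_eqI)
    fix w
    have "form (bracket w v) e = 0"
      using center_orthogonal[OF e(2) two_step_bracket_central[OF nil]]
      by (simp add: form_sym[of _ e])
    then show "form (e \<cdot> v) w = form 0 w"
      using levi_civita_central[OF e(1), of v w] by (simp add: form_simps)
  qed
  then show "v \<cdot> e = 0" using levi_civita_central_commute[OF e(1)] by simp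
qed

lemma two_step_center_perp_product:
  assumes nil: "two_step_nilpotent bracket" and "x \<in> Z_perp" "y \<in> Z_perp"
  shows "x \<cdot> y = (1/2) *\<^sub>R bracket x y"
proof (rule form_eqI)
  fix w
  have "form (bracket w x) y = 0" "form (bracket w y) x = 0"
    using assms(2,3) center_orthogonal two_step_bracket_central[OF nil]
    by (metis form_sym)+
  then show "form (x \<cdot> y) w = form ((1/2) *\<^sub>R bracket x y) w"
    using levi_civita[of x y w] by (simp add: form_simps)
qed

text \<open>
  All four products in the flatness identity for \<open>(x, y, x)\<close> are known in terms of \<open>[x, y]\<close>.
  Pairing with \<open>y\<close> is the choice that turns each of them into a multiple of the same number:
  the central left factors contribute \<open>\<langle>[y, x], \<plusminus>[x, y]\<rangle> / 4\<close>, and skewness of \<open>L\<^sub>x\<close> gives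
  \<open>\<langle>x \<cdot> (y \<cdot> x), y\<rangle> = - \<langle>y \<cdot> x, x \<cdot> y\<rangle>\<close>.
\<close>

lemma flat_two_step_bracket_isotropic:
  assumes nil: "two_step_nilpotent bracket" and flat: "flat bracket form"
    and x: "x \<in> Z_perp" and y: "y \<in> Z_perp"
  shows "form (bracket x y) (bracket x y) = 0"
proof -
  let ?c = "bracket x y"
  have c: "?c \<in> Z" by (rule two_step_bracket_central[OF nil])
  then have half_c: "(1/2) *\<^sub>R ?c \<in> Z" and neg_half_c: "- ((1/2) *\<^sub>R ?c) \<in> Z"
    by (simp_all add: lie_center_def bilinear_lmul[OF bilinear_bracket]
        bilinear_lneg[OF bilinear_bracket])
  have xy: "x \<cdot> y = (1/2) *\<^sub>R ?c"
    by (rule two_step_center_perp_product[OF nil x y])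
  have yx: "y \<cdot> x = - ((1/2) *\<^sub>R ?c)"
    using two_step_center_perp_product[OF nil y x] bracket_antisym[of y x] by simp
  have xx: "x \<cdot> x = 0"
    using two_step_center_perp_product[OF nil x x] by (simp add: alternating)
  have yx_c: "form (bracket y x) ?c = - form ?c ?c"
    using bracket_antisym[of y x] by (simp add: form_simps)
  have "form ((x \<cdot> y) \<cdot> x) y = - (1/4) * form ?c ?c"
    using levi_civita_central[OF half_c, of x y] xy yx_c by (simp add: form_simps)
  moreover have "form ((y \<cdot> x) \<cdot> x) y = (1/4) * form ?c ?c"
    using levi_civita_central[OF neg_half_c, of x y] yx yx_c by (simp add: form_simps)
  moreover have "form (x \<cdot> (y \<cdot> x)) y = (1/4) * form ?c ?c"
    using levi_civita_skew[of x "y \<cdot> x" y] xy yx by (simp add: form_simps)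
  moreover have "form (y \<cdot> (x \<cdot> x)) y = 0"
    by (simp add: xx levi_civita_zero_right form_simps)
  moreover have "form ((x \<cdot> y) \<cdot> x - x \<cdot> (y \<cdot> x)) y = form ((y \<cdot> x) \<cdot> x - y \<cdot> (x \<cdot> x)) y"
    using flat_left_symmetric[OF flat, of x y x] by simp
  ultimately show ?thesis by (simp add: form_simps)
qed

end

theorem proposition5p1:
  fixes bracket :: "'a::real_vector \<Rightarrow> 'a \<Rightarrow> 'a"
    and form :: "'a \<Rightarrow> 'a \<Rightarrow> real"
  assumes "pseudo_euclidean_lie_algebra bracket form"
    and "two_step_nilpotent bracket"
    and "flat bracket form"
  shows "degenerate_subspace form (lie_center bracket) \<and>
         (\<forall>e \<in> lie_center bracket \<inter> form_orthogonal form (lie_center bracket).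
            left_mult bracket form e = (\<lambda>_. 0) \<and> right_mult bracket form e = (\<lambda>_. 0)) \<and>
         (\<forall>x \<in> form_orthogonal form (lie_center bracket).
          \<forall>y \<in> form_orthogonal form (lie_center bracket).
            form (bracket x y) (bracket x y) = 0)"
proof -
  interpret pseudo_euclidean_lie_algebra bracket form by (rule assms(1))
  show ?thesis
    using flat_two_step_center_degenerate[OF assms(2,3)]
      two_step_center_perp_mult_zero[OF assms(2)]
      flat_two_step_bracket_isotropic[OF assms(2,3)]
    by (auto simp: left_mult_def right_mult_def)
qed

end
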